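(* The LCP algorithm is 3-competitive for the discrete data-center optimization problem: for every instance, the cost of the schedule produced by LCP is at most $3$ times the cost of an optimal schedule.
   Context: Discrete data-center optimization problem: given $T,m\in\mathbb{N}$, $\beta>0$ and convex functions $f_1,\dots,f_T:\{0,\dots,m\}\to\mathbb{R}_{\ge0}$ (convex meaning $f_t(x+1)-f_t(x)$ nondecreasing), a schedule $X=(x_1,\dots,x_T)\in\{0,\dots,m\}^T$ with $x_0=0$ has cost $C(X)=\sum_{t=1}^T f_t(x_t)+\beta\sum_{t=1}^T(x_t-x_{t-1})^+$, $(y)^+=\max(0,y)$. In the online version $f_t$ is revealed at time $t$ and $x_t$ must be chosen then. For $\tau\in\{1,\dots,T\}$ and $X=(x_1,\dots,x_\tau)$ define $C^L_\tau(X)=\sum_{t=1}^\tau f_t(x_t)+\beta\sum_{t=1}^\tau(x_t-x_{t-1})^+$ and $C^U_\tau(X)=\sum_{t=1}^\tau f_t(x_t)+\beta\sum_{t=1}^\tau(x_{t-1}-x_t)^+$. Let $x^L_\tau$ be the smallest last component among all minimizers of $C^L_\tau$ over $\{0,\dots,m\}^\tau$, and $x^U_\tau$ the largest last component among all minimizers of $C^U_\tau$. The LCP (Lazy Capacity Provisioning) algorithm sets $x^{\mathrm{LCP}}_0=0$ and $x^{\mathrm{LCP}}_\tau=\max\{x^L_\tau,\min\{x^U_\tau,x^{\mathrm{LCP}}_{\tau-1}\}\}$ for $\tau\ge1$. *)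

theory Defs
  imports Complex_Main "HOL-Library.FuncSet"
begin

text \<open>
  Time steps are \<open>1..T\<close> and states are \<open>0..m\<close>. The operating cost \<open>f t x\<close> is constrained only for
  \<open>1 \<le> t \<le> T\<close> and \<open>x \<le> m\<close>; the values of \<open>f\<close> elsewhere influence none of the notions below
  up to time \<open>T\<close>.
\<close>

definition dc_instance :: "nat \<Rightarrow> nat \<Rightarrow> real \<Rightarrow> (nat \<Rightarrow> nat \<Rightarrow> real) \<Rightarrow> bool" where
  "dc_instance T m \<beta> f \<longleftrightarrow> \<beta> > 0 \<and>
     (\<forall>t\<in>{1..T}. (\<forall>x\<in>{0..m}. f t x \<ge> 0) \<and> mono_on {0..<m} (\<lambda>x. f t (x + 1) - f t x))"

text \<open>
  A schedule \<open>(x\<^sub>1, \<dots>, x\<^sub>T)\<close> together with \<open>x\<^sub>0 = 0\<close> is a function on \<open>nat\<close>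
  whose values after time \<open>T\<close> are irrelevant (they are not fixed to a default value).
\<close>

definition schedules :: "nat \<Rightarrow> nat \<Rightarrow> (nat \<Rightarrow> nat) set" where
  "schedules T m = {X \<in> {0..T} \<rightarrow> {0..m}. X 0 = 0}"

definition cost :: "real \<Rightarrow> (nat \<Rightarrow> nat \<Rightarrow> real) \<Rightarrow> nat \<Rightarrow> (nat \<Rightarrow> nat) \<Rightarrow> real" where
  "cost \<beta> f T X =
     (\<Sum>t=1..T. f t (X t)) + \<beta> * (\<Sum>t=1..T. max 0 (real (X t) - real (X (t - 1))))"

definition costL :: "real \<Rightarrow> (nat \<Rightarrow> nat \<Rightarrow> real) \<Rightarrow> nat \<Rightarrow> (nat \<Rightarrow> nat) \<Rightarrow> real" where
  "costL \<beta> f \<tau> X =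
     (\<Sum>t=1..\<tau>. f t (X t)) + \<beta> * (\<Sum>t=1..\<tau>. max 0 (real (X t) - real (X (t - 1))))"

definition costU :: "real \<Rightarrow> (nat \<Rightarrow> nat \<Rightarrow> real) \<Rightarrow> nat \<Rightarrow> (nat \<Rightarrow> nat) \<Rightarrow> real" where
  "costU \<beta> f \<tau> X =
     (\<Sum>t=1..\<tau>. f t (X t)) + \<beta> * (\<Sum>t=1..\<tau>. max 0 (real (X (t - 1)) - real (X t)))"

definition minimizers :: "((nat \<Rightarrow> nat) \<Rightarrow> real) \<Rightarrow> nat \<Rightarrow> nat \<Rightarrow> (nat \<Rightarrow> nat) set" where
  "minimizers C \<tau> m = {X. is_arg_min C (\<lambda>X. X \<in> schedules \<tau> m) X}"

definition xL :: "nat \<Rightarrow> real \<Rightarrow> (nat \<Rightarrow> nat \<Rightarrow> real) \<Rightarrow> nat \<Rightarrow> nat" where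
  "xL m \<beta> f \<tau> = Min ((\<lambda>X. X \<tau>) ` minimizers (costL \<beta> f \<tau>) \<tau> m)"

definition xU :: "nat \<Rightarrow> real \<Rightarrow> (nat \<Rightarrow> nat \<Rightarrow> real) \<Rightarrow> nat \<Rightarrow> nat" where
  "xU m \<beta> f \<tau> = Max ((\<lambda>X. X \<tau>) ` minimizers (costU \<beta> f \<tau>) \<tau> m)"

primrec lcp :: "nat \<Rightarrow> real \<Rightarrow> (nat \<Rightarrow> nat \<Rightarrow> real) \<Rightarrow> nat \<Rightarrow> nat" where
  "lcp m \<beta> f 0 = 0"
| "lcp m \<beta> f (Suc \<tau>) =
     max (xL m \<beta> f (Suc \<tau>)) (min (xU m \<beta> f (Suc \<tau>)) (lcp m \<beta> f \<tau>))"

text \<open>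
  An algorithm maps \<open>m\<close>, \<open>\<beta>\<close> and the operating costs to a schedule; it is not told the horizon \<open>T\<close>.
\<close>

definition competitive ::
    "real \<Rightarrow> (nat \<Rightarrow> real \<Rightarrow> (nat \<Rightarrow> nat \<Rightarrow> real) \<Rightarrow> nat \<Rightarrow> nat) \<Rightarrow> bool" where
  "competitive c A \<longleftrightarrow> (\<forall>T m \<beta> f. dc_instance T m \<beta> f \<longrightarrow>
     A m \<beta> f \<in> schedules T m \<and>
     (\<forall>X \<in> minimizers (cost \<beta> f T) T m. cost \<beta> f T (A m \<beta> f) \<le> c * cost \<beta> f T X))"

text \<open>
  The following facts ensure that \<open>Min\<close> and \<open>Max\<close> above are taken over finite nonempty sets
  and that optimal schedules exist.
\<close>

lemma finite_last_minimizers: "finite ((\<lambda>X. X \<tau>) ` minimizers C \<tau> m)"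
  by (rule finite_subset[of _ "{0..m}"])
     (auto simp: minimizers_def is_arg_min_def schedules_def Pi_iff)

lemma minimizers_nonempty:
  assumes "\<And>X Y. (\<And>t. t \<le> \<tau> \<Longrightarrow> X t = Y t) \<Longrightarrow> C X = C Y"
  shows "minimizers C \<tau> m \<noteq> {}"
proof -
  have "C ` schedules \<tau> m \<subseteq> C ` ({0..\<tau>} \<rightarrow>\<^sub>E {0..m})"
  proof
    fix c assume "c \<in> C ` schedules \<tau> m"
    then obtain X where X: "X \<in> schedules \<tau> m" "c = C X" by auto
    have "c = C (restrict X {0..\<tau>})" using X(2) by (auto intro!: assms)
    moreover have "restrict X {0..\<tau>} \<in> {0..\<tau>} \<rightarrow>\<^sub>E {0..m}"
      using X(1) by (auto simp: schedules_def)
    ultimately show "c \<in> C ` ({0..\<tau>} \<rightarrow>\<^sub>E {0..m})" by blast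
  qed
  then have fin: "finite (C ` schedules \<tau> m)"
    by (rule finite_subset) (auto intro!: finite_PiE)
  have "(\<lambda>_. 0) \<in> schedules \<tau> m" by (auto simp: schedules_def)
  then have "Min (C ` schedules \<tau> m) \<in> C ` schedules \<tau> m"
    by (intro Min_in fin) auto
  then obtain X where "X \<in> schedules \<tau> m" "C X = Min (C ` schedules \<tau> m)" by auto
  then have "X \<in> minimizers C \<tau> m"
    using fin by (auto simp: minimizers_def is_arg_min_def not_less)
  then show ?thesis by blast
qed

lemma cost_minimizers_nonempty: "minimizers (cost \<beta> f \<tau>) \<tau> m \<noteq> {}"
  by (rule minimizers_nonempty) (auto simp: cost_def intro!: sum.cong)

lemma costL_minimizers_nonempty: "minimizers (costL \<beta> f \<tau>) \<tau> m \<noteq> {}"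
  by (rule minimizers_nonempty) (auto simp: costL_def intro!: sum.cong)

lemma costU_minimizers_nonempty: "minimizers (costU \<beta> f \<tau>) \<tau> m \<noteq> {}"
  by (rule minimizers_nonempty) (auto simp: costU_def intro!: sum.cong)

end

theory Submission
  imports Defs
begin

text \<open>
  Let \<open>V \<tau> x\<close> be the cheapest cost \<open>costL\<close> of a schedule up to time \<open>\<tau>\<close> followed by a move to
  the state \<open>x\<close>. Its slopes lie between \<open>0\<close> and \<open>\<beta>\<close>, and its minimum \<open>V \<tau> 0\<close> is the optimal
  cost. With \<open>p\<close> the LCP state at time \<open>\<tau>\<close>, the LCP cost up to \<open>\<tau>\<close> never exceeds
  \<open>3 V(0) - 2 (\<beta> (m - p) - (V(m) - V(p))) - (\<beta> p - (V(p) - V(0)))\<close>,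
  and both brackets are nonnegative. The potential comes from splitting the problem into \<open>m\<close>
  two-state problems, one per server: a server that is off contributes \<open>-2 (\<beta> - s)\<close> and one
  that is on contributes \<open>-(\<beta> - s)\<close>, where \<open>s\<close> is the slope of \<open>V\<close> at that server.
  Convexity of the operating cost enters only through \<open>f x \<le> max (f a) (f b)\<close> for
  \<open>a \<le> x \<le> b\<close>.
\<close>

text \<open>Slopes are nondecreasing. A negative slope at \<open>x\<close> makes every slope before
  it negative, so \<open>g\<close> decreases from \<open>a\<close> to \<open>x\<close>; otherwise
  every slope from \<open>x\<close> on is nonnegative and \<open>g\<close> increases weakly from
  \<open>x\<close> to \<open>b\<close>.\<close>

lemma convex_le_max_endpoints:
  fixes g :: "nat \<Rightarrow> real"
  assumes conv: "mono_on {0..<m} (\<lambda>x. g (x + 1) - g x)"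
    and "a \<le> x" "x \<le> b" "b \<le> m"
  shows "g x \<le> max (g a) (g b)"
proof (cases "x < m \<and> g (x + 1) - g x < 0")
  case True
  have "g x \<le> g a"
    using \<open>a \<le> x\<close>
  proof (induction rule: inc_induct)
    case (step n)
    then have "g (n + 1) - g n \<le> g (x + 1) - g x"
      using True by (intro mono_onD[OF conv]) auto
    with step True show ?case by simp
  qed simp
  then show ?thesis by simp
next
  case False
  have "g x \<le> g b"
    using \<open>x \<le> b\<close> \<open>b \<le> m\<close>
  proof (induction rule: dec_induct)
    case (step n)
    then have "g (x + 1) - g x \<le> g (n + 1) - g n"
      by (intro mono_onD[OF conv]) auto
    with step False show ?case by simp
  qed simp
  then show ?thesis by simp
qed

text \<open>Bellman recursion for the work function of online algorithms. Here \<open>y\<close> is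
  the state at time \<open>Suc \<tau>\<close> and \<open>x\<close> a hypothetical next state: moving
  up to it is charged, operating it is not. The base case is the move up from the initial state
  0.\<close>

primrec work :: "nat \<Rightarrow> real \<Rightarrow> (nat \<Rightarrow> nat \<Rightarrow> real) \<Rightarrow> nat \<Rightarrow> nat \<Rightarrow> real" where
  "work m \<beta> f 0 = (\<lambda>x. \<beta> * real x)"
| "work m \<beta> f (Suc \<tau>) = (\<lambda>x. Min ((\<lambda>y. work m \<beta> f \<tau> y + f (Suc \<tau>) y
      + \<beta> * max 0 (real x - real y)) ` {0..m}))"

lemma work_Suc_le:
  assumes "y \<le> m"
  shows "work m \<beta> f (Suc \<tau>) x
    \<le> work m \<beta> f \<tau> y + f (Suc \<tau>) y + \<beta> * max 0 (real x - real y)"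
  using assms by (auto intro: Min_le)

lemma work_Suc_attained:
  obtains y where "y \<le> m" "work m \<beta> f (Suc \<tau>) x
    = work m \<beta> f \<tau> y + f (Suc \<tau>) y + \<beta> * max 0 (real x - real y)"
proof -
  let ?c = "\<lambda>y. work m \<beta> f \<tau> y + f (Suc \<tau>) y + \<beta> * max 0 (real x - real y)"
  have "Min (?c ` {0..m}) \<in> ?c ` {0..m}"
    by (intro Min_in) auto
  then obtain y where "y \<in> {0..m}" "Min (?c ` {0..m}) = ?c y"
    by (rule imageE)
  then show thesis
    using that[of y] by simp
qed

text \<open>A minimizer \<open>z\<close> for \<open>y\<close> is a candidate for \<open>x\<close>,
  and its final move only gets cheaper.\<close>

lemma work_mono:
  assumes "\<beta> \<ge> 0" "x \<le> y"
  shows "work m \<beta> f \<tau> x \<le> work m \<beta> f \<tau> y"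
proof (cases \<tau>)
  case 0
  then show ?thesis
    using assms by (simp add: mult_left_mono)
next
  case (Suc n)
  obtain z where z: "z \<le> m" "work m \<beta> f (Suc n) y
    = work m \<beta> f n z + f (Suc n) z + \<beta> * max 0 (real y - real z)"
    by (rule work_Suc_attained)
  have "\<beta> * max 0 (real x - real z) \<le> \<beta> * max 0 (real y - real z)"
    using assms by (intro mult_left_mono) auto
  with work_Suc_le[OF z(1), of \<beta> f n x] z(2) show ?thesis unfolding Suc by linarith
qed

text \<open>A minimizer for \<open>x\<close> serves \<open>y\<close> at an extra cost of at most
  \<open>\<beta>\<close> per unit of distance.\<close>

lemma work_Lipschitz:
  assumes "\<beta> \<ge> 0" "x \<le> y"
  shows "work m \<beta> f \<tau> y - \<beta> * real y \<le> work m \<beta> f \<tau> x - \<beta> * real x"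
proof (cases \<tau>)
  case (Suc n)
  obtain z where z: "z \<le> m" "work m \<beta> f (Suc n) x
    = work m \<beta> f n z + f (Suc n) z + \<beta> * max 0 (real x - real z)"
    by (rule work_Suc_attained)
  have "\<beta> * max 0 (real y - real z) \<le> \<beta> * (max 0 (real x - real z) + (real y - real x))"
    using assms by (intro mult_left_mono) auto
  then have "\<beta> * max 0 (real y - real z)
      \<le> \<beta> * max 0 (real x - real z) + \<beta> * real y - \<beta> * real x"
    by (simp add: algebra_simps)
  with work_Suc_le[OF z(1), of \<beta> f n y] z(2) show ?thesis unfolding Suc by linarith
qed simp

section \<open>Work function and costs of schedules\<close>

lemma schedules_le: "X \<in> schedules T m \<Longrightarrow> t \<le> T \<Longrightarrow> X t \<le> m"
  by (auto simp: schedules_def Pi_iff)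

lemma schedules_SucD: "X \<in> schedules (Suc T) m \<Longrightarrow> X \<in> schedules T m"
  by (auto simp: schedules_def)

lemma costL_Suc:
  "costL \<beta> f (Suc \<tau>) X
    = costL \<beta> f \<tau> X + f (Suc \<tau>) (X (Suc \<tau>)) + \<beta> * max 0 (real (X (Suc \<tau>)) - real (X \<tau>))"
  by (simp add: costL_def algebra_simps)

lemma costL_cong: "(\<And>t. t \<le> \<tau> \<Longrightarrow> X t = Y t) \<Longrightarrow> costL \<beta> f \<tau> X = costL \<beta> f \<tau> Y"
  unfolding costL_def by (intro arg_cong2[of _ _ _ _ "(+)"] arg_cong[of _ _ "(*) \<beta>"] sum.cong) auto

text \<open>Since max(0, -d) = max(0, d) - d, the two switching costs differ by a telescoping sum,
  which starts at \<open>X 0 = 0\<close>. Hence minimizing \<open>costU\<close> means minimizing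
  \<open>costL\<close> minus \<open>\<beta>\<close> times the last state.\<close>

lemma costU_eq_costL:
  assumes "X 0 = 0"
  shows "costU \<beta> f \<tau> X = costL \<beta> f \<tau> X - \<beta> * real (X \<tau>)"
proof (induction \<tau>)
  case 0
  show ?case using assms by (simp add: costU_def costL_def)
next
  case (Suc \<tau>)
  have "max 0 (real (X \<tau>) - real (X (Suc \<tau>)))
      = max 0 (real (X (Suc \<tau>)) - real (X \<tau>)) - (real (X (Suc \<tau>)) - real (X \<tau>))"
    by simp
  then have "\<beta> * max 0 (real (X \<tau>) - real (X (Suc \<tau>)))
      = \<beta> * max 0 (real (X (Suc \<tau>)) - real (X \<tau>)) - \<beta> * real (X (Suc \<tau>)) + \<beta> * real (X \<tau>)"
    by (simp only:) (simp add: algebra_simps)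
  moreover have "costU \<beta> f (Suc \<tau>) X = costU \<beta> f \<tau> X + f (Suc \<tau>) (X (Suc \<tau>))
      + \<beta> * max 0 (real (X \<tau>) - real (X (Suc \<tau>)))"
    by (simp add: costU_def algebra_simps)
  ultimately show ?case
    using Suc.IH costL_Suc[of \<beta> f \<tau> X] by linarith
qed

lemma work_le_costL:
  assumes "X \<in> schedules \<tau> m"
  shows "work m \<beta> f \<tau> x \<le> costL \<beta> f \<tau> X + \<beta> * max 0 (real x - real (X \<tau>))"
  using assms
proof (induction \<tau> arbitrary: x)
  case 0
  then show ?case by (simp add: schedules_def costL_def)
next
  case (Suc \<tau>)
  show ?case
    using Suc.IH[OF schedules_SucD[OF Suc.prems], of "X (Suc \<tau>)"]
      work_Suc_le[OF schedules_le[OF Suc.prems order_refl], of \<beta> f \<tau> x]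
      costL_Suc[of \<beta> f \<tau> X]
    by linarith
qed

lemma work_attained_by_schedule:
  obtains X where "X \<in> schedules \<tau> m"
    "work m \<beta> f \<tau> x = costL \<beta> f \<tau> X + \<beta> * max 0 (real x - real (X \<tau>))"
proof (induction \<tau> arbitrary: x thesis)
  case 0
  show ?case
    by (rule 0[of "\<lambda>_. 0"]) (auto simp: schedules_def costL_def)
next
  case (Suc \<tau>)
  obtain y where y: "y \<le> m" "work m \<beta> f (Suc \<tau>) x
    = work m \<beta> f \<tau> y + f (Suc \<tau>) y + \<beta> * max 0 (real x - real y)"
    by (rule work_Suc_attained)
  obtain X where X: "X \<in> schedules \<tau> m"
    "work m \<beta> f \<tau> y = costL \<beta> f \<tau> X + \<beta> * max 0 (real y - real (X \<tau>))"
    by (rule Suc.IH)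
  let ?Y = "X(Suc \<tau> := y)"
  have "costL \<beta> f \<tau> ?Y = costL \<beta> f \<tau> X"
    by (rule costL_cong) auto
  then have "work m \<beta> f (Suc \<tau>) x = costL \<beta> f (Suc \<tau>) ?Y + \<beta> * max 0 (real x - real (?Y (Suc \<tau>)))"
    using X(2) y(2) by (simp add: costL_Suc del: work.simps)
  moreover have "?Y \<in> schedules (Suc \<tau>) m"
    using X(1) y(1) by (auto simp: schedules_def Pi_iff le_Suc_eq)
  ultimately show ?case by (rule Suc.prems[rotated])
qed

text \<open>With \<open>costL_Suc_ge_work\<close>, this identifies
  \<open>work m \<beta> f \<tau> x + f (Suc \<tau>) x\<close> as the least \<open>costL\<close> of a
  schedule ending in \<open>x\<close>, which turns minimization over schedules into minimization
  over single states.\<close>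

lemma schedule_through_state:
  assumes "x \<le> m"
  obtains X where "X \<in> schedules (Suc \<tau>) m" "X (Suc \<tau>) = x"
    "costL \<beta> f (Suc \<tau>) X = work m \<beta> f \<tau> x + f (Suc \<tau>) x"
proof -
  obtain X where X: "X \<in> schedules \<tau> m"
    "work m \<beta> f \<tau> x = costL \<beta> f \<tau> X + \<beta> * max 0 (real x - real (X \<tau>))"
    by (rule work_attained_by_schedule)
  let ?Y = "X(Suc \<tau> := x)"
  have "costL \<beta> f \<tau> ?Y = costL \<beta> f \<tau> X"
    by (rule costL_cong) auto
  then have "costL \<beta> f (Suc \<tau>) ?Y = work m \<beta> f \<tau> x + f (Suc \<tau>) x"
    using X(2) by (simp add: costL_Suc)
  moreover have "?Y \<in> schedules (Suc \<tau>) m"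
    using X(1) assms by (auto simp: schedules_def Pi_iff le_Suc_eq)
  ultimately show thesis
    using that by simp
qed

lemma costL_Suc_ge_work:
  assumes "X \<in> schedules (Suc \<tau>) m"
  shows "work m \<beta> f \<tau> (X (Suc \<tau>)) + f (Suc \<tau>) (X (Suc \<tau>)) \<le> costL \<beta> f (Suc \<tau>) X"
  using work_le_costL[OF schedules_SucD[OF assms], of \<beta> f "X (Suc \<tau>)"] by (simp add: costL_Suc)

section \<open>The LCP bounds as minimizers over states\<close>

lemma xL_attained:
  obtains X where "X \<in> minimizers (costL \<beta> f \<tau>) \<tau> m" "xL m \<beta> f \<tau> = X \<tau>"
proof -
  have "xL m \<beta> f \<tau> \<in> (\<lambda>X. X \<tau>) ` minimizers (costL \<beta> f \<tau>) \<tau> m"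
    unfolding xL_def
    by (intro Min_in finite_last_minimizers) (simp add: costL_minimizers_nonempty)
  then show thesis using that by auto
qed

lemma xU_attained:
  obtains X where "X \<in> minimizers (costU \<beta> f \<tau>) \<tau> m" "xU m \<beta> f \<tau> = X \<tau>"
proof -
  have "xU m \<beta> f \<tau> \<in> (\<lambda>X. X \<tau>) ` minimizers (costU \<beta> f \<tau>) \<tau> m"
    unfolding xU_def
    by (intro Max_in finite_last_minimizers) (simp add: costU_minimizers_nonempty)
  then show thesis using that by auto
qed

lemma minimizersD:
  assumes "X \<in> minimizers C \<tau> m"
  shows "X \<in> schedules \<tau> m" "Y \<in> schedules \<tau> m \<Longrightarrow> C X \<le> C Y"
  using assms by (auto simp: minimizers_def is_arg_min_def not_less)

lemma xL_le: "xL m \<beta> f \<tau> \<le> m"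
  by (rule xL_attained[of \<beta> f \<tau> m]) (auto dest!: minimizersD(1) simp: schedules_le)

lemma xU_le: "xU m \<beta> f \<tau> \<le> m"
  by (rule xU_attained[of \<beta> f \<tau> m]) (auto dest!: minimizersD(1) simp: schedules_le)

lemma xL_minimizes_work:
  assumes "x \<le> m"
  shows "work m \<beta> f \<tau> (xL m \<beta> f (Suc \<tau>)) + f (Suc \<tau>) (xL m \<beta> f (Suc \<tau>))
    \<le> work m \<beta> f \<tau> x + f (Suc \<tau>) x"
proof -
  obtain X where X: "X \<in> minimizers (costL \<beta> f (Suc \<tau>)) (Suc \<tau>) m"
    "xL m \<beta> f (Suc \<tau>) = X (Suc \<tau>)"
    by (rule xL_attained)
  obtain Y where Y: "Y \<in> schedules (Suc \<tau>) m" "Y (Suc \<tau>) = x"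
    "costL \<beta> f (Suc \<tau>) Y = work m \<beta> f \<tau> x + f (Suc \<tau>) x"
    using assms by (rule schedule_through_state)
  show ?thesis
    using costL_Suc_ge_work[OF minimizersD(1)[OF X(1)], of \<beta> f] minimizersD(2)[OF X(1) Y(1)] X(2) Y(3)
    by simp
qed

lemma xU_minimizes_work:
  assumes "x \<le> m"
  shows "work m \<beta> f \<tau> (xU m \<beta> f (Suc \<tau>)) + f (Suc \<tau>) (xU m \<beta> f (Suc \<tau>))
      - \<beta> * real (xU m \<beta> f (Suc \<tau>))
    \<le> work m \<beta> f \<tau> x + f (Suc \<tau>) x - \<beta> * real x"
proof -
  obtain X where X: "X \<in> minimizers (costU \<beta> f (Suc \<tau>)) (Suc \<tau>) m"
    "xU m \<beta> f (Suc \<tau>) = X (Suc \<tau>)"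
    by (rule xU_attained)
  obtain Y where Y: "Y \<in> schedules (Suc \<tau>) m" "Y (Suc \<tau>) = x"
    "costL \<beta> f (Suc \<tau>) Y = work m \<beta> f \<tau> x + f (Suc \<tau>) x"
    using assms by (rule schedule_through_state)
  have "X 0 = 0" "Y 0 = 0"
    using minimizersD(1)[OF X(1)] Y(1) by (auto simp: schedules_def)
  then show ?thesis
    using costL_Suc_ge_work[OF minimizersD(1)[OF X(1)], of \<beta> f] minimizersD(2)[OF X(1) Y(1)] X(2) Y(2,3)
    by (simp add: costU_eq_costL)
qed

text \<open>Moving down to 0 is free, so the recursion at 0 minimizes the same function of the last
  state as \<open>xL\<close>.\<close>

lemma work_Suc_0_ge:
  "work m \<beta> f \<tau> (xL m \<beta> f (Suc \<tau>)) + f (Suc \<tau>) (xL m \<beta> f (Suc \<tau>))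
    \<le> work m \<beta> f (Suc \<tau>) 0"
proof -
  obtain z where z: "z \<le> m" "work m \<beta> f (Suc \<tau>) 0
    = work m \<beta> f \<tau> z + f (Suc \<tau>) z + \<beta> * max 0 (real 0 - real z)"
    by (rule work_Suc_attained)
  show ?thesis
    using xL_minimizes_work[OF z(1), of \<beta> f \<tau>] z(2) by simp
qed

text \<open>Every \<open>z\<close> pays the full \<open>\<beta> * (m - z)\<close> to reach the top
  state, so up to the constant \<open>\<beta> * m\<close> the recursion at \<open>m\<close>
  minimizes what \<open>xU\<close> minimizes.\<close>

lemma work_Suc_m_ge:
  "work m \<beta> f \<tau> (xU m \<beta> f (Suc \<tau>)) + f (Suc \<tau>) (xU m \<beta> f (Suc \<tau>))
      + \<beta> * (real m - real (xU m \<beta> f (Suc \<tau>)))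
    \<le> work m \<beta> f (Suc \<tau>) m"
proof -
  obtain z where z: "z \<le> m" "work m \<beta> f (Suc \<tau>) m
    = work m \<beta> f \<tau> z + f (Suc \<tau>) z + \<beta> * max 0 (real m - real z)"
    by (rule work_Suc_attained)
  show ?thesis
    using xU_minimizes_work[OF z(1), of \<beta> f \<tau>] z by (simp add: right_diff_distrib)
qed

section \<open>Feasibility and cost of LCP\<close>

lemma lcp_le: "lcp m \<beta> f \<tau> \<le> m"
  by (cases \<tau>) (simp_all add: xL_le xU_le min.coboundedI1)

lemma lcp_in_schedules: "lcp m \<beta> f \<in> schedules T m"
  by (simp add: schedules_def lcp_le)

text \<open>The right-hand side is the potential multiplied out. In the induction step its growth
  splits into an operating part, bounded below by \<open>g_q\<close>, and a switching part, bounded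
  below by \<open>switch\<close>.\<close>

lemma costL_lcp_le_potential:
  assumes "\<beta> \<ge> 0"
    and nonneg: "\<And>t x. t \<in> {1..\<tau>} \<Longrightarrow> x \<le> m \<Longrightarrow> f t x \<ge> 0"
    and conv: "\<And>t. t \<in> {1..\<tau>} \<Longrightarrow> mono_on {0..<m} (\<lambda>x. f t (x + 1) - f t x)"
  defines "p \<equiv> lcp m \<beta> f" and "V \<equiv> work m \<beta> f"
  shows "costL \<beta> f \<tau> p
    \<le> 2 * V \<tau> 0 + 2 * V \<tau> m - V \<tau> (p \<tau>) - 2 * (\<beta> * real m) + \<beta> * real (p \<tau>)"
  using nonneg conv
proof (induction \<tau>)
  case 0
  show ?case by (simp add: p_def V_def costL_def)
next
  case (Suc \<tau>)
  let ?a = "xL m \<beta> f (Suc \<tau>)" and ?b = "xU m \<beta> f (Suc \<tau>)" and ?g = "f (Suc \<tau>)"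
  let ?q = "p (Suc \<tau>)"
  have IH: "costL \<beta> f \<tau> p
      \<le> 2 * V \<tau> 0 + 2 * V \<tau> m - V \<tau> (p \<tau>) - 2 * (\<beta> * real m) + \<beta> * real (p \<tau>)"
    by (rule Suc.IH; rule Suc.prems) auto
  have q: "?q = max ?a (min ?b (p \<tau>))"
    by (simp add: p_def)
  have le_m: "?a \<le> m" "?b \<le> m" "p \<tau> \<le> m" "?q \<le> m"
    by (simp_all add: xL_le xU_le p_def lcp_le del: lcp.simps)
  have "?g x \<ge> 0" if "x \<le> m" for x
    using Suc.prems(1)[of "Suc \<tau>"] that by simp
  then have g0: "?g ?a \<ge> 0" "?g ?b \<ge> 0"
    using le_m by blast+
  \<comment> \<open>The potential gains at least twice the sum on the right from \<open>V0\<close>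
    and \<open>Vm\<close> and loses at most \<open>?g ?q\<close> through \<open>Vq\<close>, so this
    bound leaves enough to pay \<open>?g ?q\<close>. The case split avoids proving that
    \<open>?a\<close> is at most \<open>?b\<close>.\<close>
  have g_q: "?g ?q \<le> ?g ?a + ?g ?b"
  proof (cases "?q \<le> ?b")
    case True
    have "?g ?q \<le> max (?g ?a) (?g ?b)"
      by (rule convex_le_max_endpoints[where m = m])
        (use True le_m q Suc.prems(2)[of "Suc \<tau>"] in auto)
    with g0 show ?thesis by linarith
  next
    case False
    then have "?q = ?a" using q by linarith
    with g0 show ?thesis by simp
  qed
  have mono: "V \<tau> x \<le> V \<tau> y" if "x \<le> y" for x y
    unfolding V_def using assms(1) that by (rule work_mono)
  have lip: "V \<tau> y - \<beta> * real y \<le> V \<tau> x - \<beta> * real x" if "x \<le> y" for x y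
    unfolding V_def using assms(1) that by (rule work_Lipschitz)
  have V0: "V \<tau> ?a + ?g ?a \<le> V (Suc \<tau>) 0"
    unfolding V_def by (rule work_Suc_0_ge)
  have Vm: "V \<tau> ?b + ?g ?b + \<beta> * real m - \<beta> * real ?b \<le> V (Suc \<tau>) m"
    using work_Suc_m_ge[of m \<beta> f \<tau>] by (simp add: V_def algebra_simps del: work.simps)
  have Vq: "V (Suc \<tau>) ?q \<le> V \<tau> ?q + ?g ?q"
    using work_Suc_le[OF le_m(4), of \<beta> f \<tau> ?q] by (simp add: V_def del: work.simps)
  define s where "s = \<beta> * max 0 (real ?q - real (p \<tau>))"
  have switch: "s \<le> 2 * (V \<tau> ?a - V \<tau> 0) + 2 * (V \<tau> ?b - \<beta> * real ?b - (V \<tau> m - \<beta> * real m))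
        + V \<tau> (p \<tau>) - V \<tau> ?q + \<beta> * real ?q - \<beta> * real (p \<tau>)"
  proof -
    note bounds = mono[OF le0, of ?a] mono[OF le0, of "p \<tau>"] lip[OF le_m(2)] lip[OF le_m(3)]
    \<comment> \<open>LCP moves up only to \<open>?a\<close>. It moves down only when
      \<open>?b\<close> lies below \<open>p \<tau>\<close>, and then it does not go below
      \<open>?b\<close>.\<close>
    consider "?q > p \<tau>" "?q = ?a" | "?q = p \<tau>" | "?q < p \<tau>" "?b \<le> ?q"
      using q by linarith
    then show ?thesis
    proof cases
      case 1
      then have "s = \<beta> * real ?q - \<beta> * real (p \<tau>)"
        by (simp add: s_def right_diff_distrib)
      with bounds 1 show ?thesis by simp
    next
      case 2
      with bounds show ?thesis by (simp add: s_def)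
    next
      case 3
      then have "s = 0"
        by (simp add: s_def)
      \<comment> \<open>Moving down is free, but the potential also changes with the state;
        \<open>?b \<le> ?q\<close> bounds the term at \<open>?q\<close> by the one at
        \<open>?b\<close>.\<close>
      with bounds lip[OF 3(2)] show ?thesis by simp
    qed
  qed
  show ?case
    using IH g_q V0 Vm Vq switch costL_Suc[of \<beta> f \<tau> p, folded s_def] by (simp add: algebra_simps)
qed

theorem theorem3p13:
  shows "competitive 3 lcp"
  unfolding competitive_def
proof (intro allI impI conjI ballI)
  fix T m \<beta> f
  assume inst: "dc_instance T m \<beta> f"
  show "lcp m \<beta> f \<in> schedules T m"
    by (rule lcp_in_schedules)
  fix X
  assume "X \<in> minimizers (cost \<beta> f T) T m"
  then have X: "X \<in> schedules T m"
    by (rule minimizersD(1))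
  have \<beta>: "\<beta> \<ge> 0"
    using inst by (simp add: dc_instance_def)
  let ?V = "work m \<beta> f T" and ?p = "lcp m \<beta> f T"
  have "costL \<beta> f T (lcp m \<beta> f)
      \<le> 2 * ?V 0 + 2 * ?V m - ?V ?p - 2 * (\<beta> * real m) + \<beta> * real ?p"
    by (rule costL_lcp_le_potential) (use inst \<beta> in \<open>auto simp: dc_instance_def\<close>)
  \<comment> \<open>Both brackets of the potential are nonnegative, which leaves the bound
    \<open>3 * ?V 0\<close>.\<close>
  moreover have "?V m - \<beta> * real m \<le> ?V ?p - \<beta> * real ?p" "?V ?p - \<beta> * real ?p \<le> ?V 0"
    using work_Lipschitz[OF \<beta> lcp_le[of m \<beta> f T], of m f T]
      work_Lipschitz[OF \<beta>, of 0 ?p m f T]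
    by simp_all
  moreover have "?V 0 \<le> costL \<beta> f T X"
    using work_le_costL[OF X, of \<beta> f 0] by simp
  moreover have "cost \<beta> f T = costL \<beta> f T"
    by (simp add: fun_eq_iff cost_def costL_def)
  ultimately show "cost \<beta> f T (lcp m \<beta> f) \<le> 3 * cost \<beta> f T X"
    by simp
qed

end
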